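(* Let $\lambda$ be a nonzero real number. For every integer $n\ge 0$, $$\beta_{n,\lambda}(x)=\sum_{k=0}^{n}\Big\{\sum_{l=0}^{n}\binom{n}{l}\beta_{n-l,\lambda}\,S_{1,\lambda}(l,k)\Big\}\phi_{k,\lambda}(x).$$
   Context: For $\lambda\neq 0$: $(x)_{0,\lambda}=1$ and $(x)_{n,\lambda}=x(x-\lambda)\cdots(x-(n-1)\lambda)$ for $n\ge1$. The degenerate exponential is $e_\lambda^{x}(t)=\sum_{k\ge0}(x)_{k,\lambda}\frac{t^k}{k!}=(1+\lambda t)^{x/\lambda}$, $e_\lambda(t)=e_\lambda^1(t)$, and $\log_\lambda(1+t)=\frac{1}{\lambda}\big((1+t)^\lambda-1\big)$ is the compositional inverse of $e_\lambda(t)$. The degenerate Stirling numbers of the first kind are defined by $\frac{1}{k!}(\log_\lambda(1+t))^k=\sum_{n\ge k}S_{1,\lambda}(n,k)\frac{t^n}{n!}$, with $S_{1,\lambda}(n,k)=0$ for $n<k$. The degenerate Bernoulli polynomials are defined by $\frac{t}{e_\lambda(t)-1}e_\lambda^{x}(t)=\sum_{n\ge0}\beta_{n,\lambda}(x)\frac{t^n}{n!}$, and $\beta_{n,\lambda}=\beta_{n,\lambda}(0)$. The fully degenerate Bell polynomials $\phi_{n,\lambda}(x)$ are defined by $e_\lambda^{x}\big(e_\lambda(t)-1\big)=\sum_{n\ge0}\phi_{n,\lambda}(x)\frac{t^n}{n!}$. *)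

theory Defs
  imports "HOL-Computational_Algebra.Formal_Power_Series"
begin

text \<open>All generating functions are formal power series over the reals in the
  variable \<open>t\<close> (\<^term>\<open>fps_X\<close>); the polynomials in \<open>x\<close> are represented by the
  real functions they induce.\<close>

definition degen_falling :: "real \<Rightarrow> real \<Rightarrow> nat \<Rightarrow> real" where
  "degen_falling lam x n = (\<Prod>i<n. x - real i * lam)"

definition degen_exp :: "real \<Rightarrow> real \<Rightarrow> real fps" where
  "degen_exp lam x = Abs_fps (\<lambda>k. degen_falling lam x k / fact k)"

text \<open>The series \<open>log\<^sub>\<lambda>(1 + t)\<close>; \<^term>\<open>fps_binomial lam\<close> is \<open>(1 + t)\<^sup>\<lambda>\<close>.\<close>

definition degen_log :: "real \<Rightarrow> real fps" where
  "degen_log lam = fps_const (1 / lam) * (fps_binomial lam - 1)"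

definition degen_stirling1 :: "real \<Rightarrow> nat \<Rightarrow> nat \<Rightarrow> real" where
  "degen_stirling1 lam n k =
     fact n * fps_nth (fps_const (1 / fact k) * degen_log lam ^ k) n"

text \<open>The divisor \<open>e\<^sub>\<lambda>(t) - 1\<close> has subdegree \<open>1\<close>, so division on \<^typ>\<open>real fps\<close>
  cancels the common factor \<open>t\<close> and the quotient is exact.\<close>

definition degen_bernoulli_poly :: "real \<Rightarrow> nat \<Rightarrow> real \<Rightarrow> real" where
  "degen_bernoulli_poly lam n x =
     fact n * fps_nth (fps_X / (degen_exp lam 1 - 1) * degen_exp lam x) n"

definition degen_bernoulli :: "real \<Rightarrow> nat \<Rightarrow> real" where
  "degen_bernoulli lam n = degen_bernoulli_poly lam n 0"

definition full_degen_bell :: "real \<Rightarrow> nat \<Rightarrow> real \<Rightarrow> real" where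
  "full_degen_bell lam n x =
     fact n * fps_nth (fps_compose (degen_exp lam x) (degen_exp lam 1 - 1)) n"

lemma degen_stirling1_eq_0:
  assumes "n < k"
  shows "degen_stirling1 lam n k = 0"
proof -
  have "fps_nth (degen_log lam) 0 = 0"
    by (simp add: degen_log_def)
  then have "fps_nth (degen_log lam ^ k) n = 0"
    using assms by (simp add: startsby_zero_power_prefix)
  then show ?thesis
    by (simp add: degen_stirling1_def)
qed

lemma subdegree_degen_exp_minus_1: "subdegree (degen_exp lam 1 - 1) = 1"
  by (rule subdegreeI) (auto simp: degen_exp_def degen_falling_def)

lemma degen_bernoulli_poly_gf:
  "(degen_exp lam 1 - 1) * Abs_fps (\<lambda>n. degen_bernoulli_poly lam n x / fact n)
     = fps_X * degen_exp lam x"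
proof -
  let ?d = "degen_exp lam 1 - 1"
  have nz: "?d \<noteq> 0"
    using subdegree_degen_exp_minus_1[of lam] by (metis subdegree_0 zero_neq_one)
  have "?d dvd fps_X"
    unfolding fps_dvd_iff[OF nz fps_X_neq_zero] subdegree_degen_exp_minus_1
    by simp
  then have "?d * (fps_X / ?d) = fps_X"
    by simp
  moreover have "Abs_fps (\<lambda>n. degen_bernoulli_poly lam n x / fact n)
      = fps_X / ?d * degen_exp lam x"
    by (rule fps_ext) (simp add: degen_bernoulli_poly_def)
  ultimately show ?thesis
    by (simp add: mult.assoc[symmetric])
qed

end

theory Submission imports Defs begin

text \<open>
  Since \<open>log\<^sub>\<lambda>(1 + t)\<close> is the compositional inverse of \<open>e\<^sub>\<lambda>(t) - 1\<close>,
  substituting it into the generating function of the fully degenerate Bell polynomials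
  gives \<open>e\<^sub>\<lambda>\<^sup>x(t) = \<Sum>\<^sub>k \<phi>\<^sub>k\<^sub>,\<^sub>\<lambda>(x) log\<^sub>\<lambda>(1 + t)\<^sup>k / k!\<close>. Multiplying by
  \<open>t / (e\<^sub>\<lambda>(t) - 1)\<close> and comparing coefficients yields the claim. The inverse relation
  is the power law \<open>((1 + t)\<^sup>b)\<^sup>a = (1 + t)\<^sup>a\<^sup>b\<close> for formal binomial series, because
  \<open>e\<^sub>\<lambda>\<^sup>x(t) = (1 + \<lambda>t)\<^bsup>x/\<lambda>\<^esup>\<close>.
\<close>

unbundle fps_syntax

text \<open>The differential equation of \<open>(1 + t)^c\<close> with its denominator cleared, so
  that a series can be substituted without composing a quotient.\<close>

lemma one_plus_X_mult_deriv_fps_binomial: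
  fixes c :: "'a::field_char_0"
  shows "(1 + fps_X) * fps_deriv (fps_binomial c) = fps_const c * fps_binomial c"
proof -
  have "(1 + fps_X :: 'a fps) $ 0 \<noteq> 0" by simp
  then show ?thesis
    by (simp add: fps_binomial_deriv fps_divide_unit mult.left_commute inverse_mult_eq_1')
qed

text \<open>Both sides have constant term 1 and solve \<open>(1 + t) g' = a b g\<close>, which has
  only one such solution.\<close>

lemma fps_binomial_compose_fps_binomial:
  fixes a b :: "'a::field_char_0"
  shows "fps_binomial a oo (fps_binomial b - 1) = fps_binomial (a * b)"
proof -
  let ?u = "fps_binomial b - 1"
  let ?g = "fps_binomial a oo ?u"
  let ?d = "fps_deriv (fps_binomial a) oo ?u"
  have u0: "?u $ 0 = 0" by simp
  have one_plus_X_nz: "(1 + fps_X :: 'a fps) \<noteq> 0"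
    by (auto simp: fps_eq_iff)
  have "((1 + fps_X) * fps_deriv (fps_binomial a)) oo ?u = (fps_const a * fps_binomial a) oo ?u"
    by (simp only: one_plus_X_mult_deriv_fps_binomial)
  \<comment> \<open>Substituting \<open>?u\<close> turns the factor \<open>1 + fps_X\<close> into
    \<open>fps_binomial b\<close>.\<close>
  then have *: "fps_binomial b * ?d = fps_const a * ?g"
    by (simp add: fps_compose_mult_distrib[OF u0] fps_compose_add_distrib)
  have "(1 + fps_X) * fps_deriv ?g = ?d * ((1 + fps_X) * fps_deriv (fps_binomial b))"
    by (simp add: fps_compose_deriv[OF u0] mult_ac)
  also have "\<dots> = fps_const b * (fps_binomial b * ?d)"
    unfolding one_plus_X_mult_deriv_fps_binomial by (simp only: mult_ac)
  also have "\<dots> = fps_const (a * b) * ?g"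
    by (simp only: * fps_const_mult[symmetric] mult_ac)
  finally have "fps_deriv ?g = fps_const (a * b) * ?g / (1 + fps_X)"
    using nonzero_mult_div_cancel_left[OF one_plus_X_nz] by metis
  moreover have "?g $ 0 = 1" by simp
  ultimately show ?thesis
    using fps_binomial_ODE_unique' by blast
qed

lemma degen_exp_eq_fps_binomial_compose:
  assumes "lam \<noteq> 0"
  shows "degen_exp lam x = fps_binomial (x / lam) oo (fps_const lam * fps_X)"
proof (rule fps_ext)
  fix n
  \<comment> \<open>Scaling the variable by \<open>lam\<close> contributes \<open>lam ^ n\<close>:
    one \<open>lam\<close> for each factor of the falling factorial in the binomial
    coefficient.\<close>
  have "lam ^ n * (\<Prod>i<n. x / lam - real i) = (\<Prod>i<n. lam * (x / lam - real i))"
    by (simp add: prod.distrib)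
  also have "\<dots> = (\<Prod>i<n. x - real i * lam)"
    using assms by (intro prod.cong) (auto simp: field_simps)
  finally show "degen_exp lam x $ n = (fps_binomial (x / lam) oo (fps_const lam * fps_X)) $ n"
    by (simp add: degen_exp_def degen_falling_def gbinomial_prod_rev atLeast0LessThan)
qed

lemma degen_log_nth_0: "degen_log lam $ 0 = 0"
  by (simp add: degen_log_def)

text \<open>Since \<open>1 + lam * degen_log lam\<close> is \<open>(1 + t)^lam\<close>, the power
  law applies with exponents \<open>x / lam\<close> and \<open>lam\<close>.\<close>

lemma degen_exp_compose_degen_log:
  assumes "lam \<noteq> 0"
  shows "degen_exp lam x oo degen_log lam = fps_binomial x"
proof -
  have "(fps_const lam * fps_X) oo degen_log lam = fps_const lam * degen_log lam"
    by (simp add: fps_compose_mult_distrib degen_log_nth_0)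
  also have "\<dots> = fps_binomial lam - 1"
    using assms by (simp add: degen_log_def mult.assoc[symmetric])
  finally have "degen_exp lam x oo degen_log lam = fps_binomial (x / lam) oo (fps_binomial lam - 1)"
    by (simp add: degen_exp_eq_fps_binomial_compose[OF assms] degen_log_nth_0
        flip: fps_compose_assoc)
  then show ?thesis
    using assms by (simp add: fps_binomial_compose_fps_binomial)
qed

lemma degen_exp_minus_1_compose_degen_log:
  assumes "lam \<noteq> 0"
  shows "(degen_exp lam 1 - 1) oo degen_log lam = fps_X"
  using assms
  by (simp add: fps_compose_sub_distrib degen_exp_compose_degen_log fps_binomial_1)

lemma degen_exp_nth_eq_sum_bell:
  assumes "lam \<noteq> 0" and "l \<le> n"
  shows "fact l * degen_exp lam x $ l
    = (\<Sum>k=0..n. degen_stirling1 lam l k * full_degen_bell lam k x)"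
proof -
  let ?P = "degen_exp lam x oo (degen_exp lam 1 - 1)"
  have "(degen_exp lam 1 - 1) $ 0 = 0"
    by (simp add: degen_exp_def degen_falling_def)
  then have "degen_exp lam x = ?P oo degen_log lam"
    using degen_exp_minus_1_compose_degen_log[OF assms(1)] degen_log_nth_0
    by (simp flip: fps_compose_assoc)
  then have "degen_exp lam x $ l = (\<Sum>k=0..l. ?P $ k * degen_log lam ^ k $ l)"
    by (metis fps_compose_nth)
  then have "fact l * degen_exp lam x $ l
      = (\<Sum>k=0..l. degen_stirling1 lam l k * full_degen_bell lam k x)"
    by (simp add: sum_distrib_left degen_stirling1_def full_degen_bell_def mult_ac)
  \<comment> \<open>The terms with \<open>l < k\<close> vanish. A bound independent of
    \<open>l\<close> allows the later exchange of sums.\<close>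
  also have "\<dots> = (\<Sum>k=0..n. degen_stirling1 lam l k * full_degen_bell lam k x)"
    using assms(2) by (intro sum.mono_neutral_left) (auto simp: degen_stirling1_eq_0)
  finally show ?thesis .
qed

lemma degen_exp_0: "degen_exp lam 0 = 1"
proof (rule fps_ext)
  fix n show "degen_exp lam 0 $ n = 1 $ n"
    by (cases n) (auto simp: degen_exp_def degen_falling_def prod_zero_iff)
qed

lemma degen_bernoulli_poly_eq_sum:
  "degen_bernoulli_poly lam n x
    = (\<Sum>l=0..n. real (n choose l) * degen_bernoulli lam (n - l) * (fact l * degen_exp lam x $ l))"
proof -
  let ?B = "fps_X / (degen_exp lam 1 - 1)"
  have "degen_bernoulli_poly lam n x = fact n * (degen_exp lam x * ?B) $ n"
    by (simp add: degen_bernoulli_poly_def mult.commute)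
  also have "\<dots> = (\<Sum>l=0..n. fact n * (degen_exp lam x $ l * ?B $ (n - l)))"
    by (simp add: fps_mult_nth sum_distrib_left)
  also have "\<dots> = (\<Sum>l=0..n. real (n choose l) * degen_bernoulli lam (n - l)
                        * (fact l * degen_exp lam x $ l))"
    \<comment> \<open>At \<open>x = 0\<close> the exponential factor is 1, so the coefficients of
      \<open>?B\<close> are the degenerate Bernoulli numbers divided by factorials.\<close>
    by (intro sum.cong refl)
       (simp add: degen_bernoulli_def degen_bernoulli_poly_def degen_exp_0 binomial_fact)
  finally show ?thesis .
qed

theorem theorem5:
  fixes lam x :: real and n :: nat
  assumes "lam \<noteq> 0"
  shows "degen_bernoulli_poly lam n x =
    (\<Sum>k=0..n. (\<Sum>l=0..n. real (n choose l) * degen_bernoulli lam (n - l)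
                  * degen_stirling1 lam l k) * full_degen_bell lam k x)"
proof -
  have "degen_bernoulli_poly lam n x
    = (\<Sum>l=0..n. \<Sum>k=0..n. real (n choose l) * degen_bernoulli lam (n - l)
                  * degen_stirling1 lam l k * full_degen_bell lam k x)"
    unfolding degen_bernoulli_poly_eq_sum
    by (intro sum.cong refl)
       (simp add: degen_exp_nth_eq_sum_bell[OF assms, of _ n] sum_distrib_left mult.assoc)
  also have "\<dots> = (\<Sum>k=0..n. \<Sum>l=0..n. real (n choose l) * degen_bernoulli lam (n - l)
                  * degen_stirling1 lam l k * full_degen_bell lam k x)"
    by (rule sum.swap)
  finally show ?thesis
    by (simp add: sum_distrib_right)
qed

end
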